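(* Let $\Bbbk$ be an algebraically closed field of characteristic $p>0$, let $1\leq n\leq p$, and let $V_n$ be the $n$-dimensional indecomposable representation over $\Bbbk$ of the cyclic group $C_p=\langle\sigma\rangle$ of order $p$, with coordinate functions $x_1,\dots,x_n$ chosen so that $\Bbbk[V_n]=\Bbbk[x_1,\dots,x_n]$, $\sigma\cdot x_i=x_i+x_{i+1}$ for $1\leq i\leq n-1$, and $\sigma\cdot x_n=x_n$. Consider the triangular array with entries $u_{i,j}$ in row $i$ and column $j$ given by \[ u_{i,i}=\operatorname{N}(x_i)\ (1\leq i\leq n-1),\qquad u_{i,j}=\operatorname{Tr}(x_ix_j^{p-1})\ (1\leq i<j\leq n-1),\qquad u_{n,n}=x_n^p, \] with no other entries. Then the set $S_n$ consisting of the sums of the entries on the diagonals of this triangle, i.e. of the sums \[\sum_{i+j=k}u_{i,j}\qquad (2\leq k\leq 2n-2)\] over the entries of the array with $i+j=k$, together with $x_n^p$ (the diagonal $k=2n$), is a separating set for $\Bbbk[V_n]^{C_p}$.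
   Context: For $f\in\Bbbk[V_n]$, the norm is $\operatorname{N}(f)=\prod_{i=0}^{p-1}(\sigma^i\cdot f)$ and the trace is $\operatorname{Tr}(f)=\sum_{i=0}^{p-1}(\sigma^i\cdot f)$. For a finite group $G$ acting linearly on $V$, a separating set is a subset $E\subset\Bbbk[V]^G$ of the ring of invariants such that whenever $v,w\in V$ have distinct $G$-orbits there is $h\in E$ with $h(v)\neq h(w)$. *)

theory Defs
  imports
    "HOL-Algebra.Group_Action"
    "HOL-Algebra.Generated_Groups"
    "HOL-Computational_Algebra.Polynomial"
    "HOL-Library.Poly_Mapping"
begin

text \<open>A polynomial is a finitely supported map from exponent vectors to coefficients; the ring
  operations (including the convolution product) are those of \<^theory>\<open>HOL-Library.Poly_Mapping\<close>.\<close>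

type_synonym 'k mpoly = "(nat \<Rightarrow>\<^sub>0 nat) \<Rightarrow>\<^sub>0 'k"

definition var :: "nat \<Rightarrow> 'k::comm_ring_1 mpoly" where
  "var i = Poly_Mapping.single (Poly_Mapping.single i 1) 1"

definition const :: "'k::comm_ring_1 \<Rightarrow> 'k mpoly" where
  "const c = Poly_Mapping.single 0 c"

definition polys :: "nat \<Rightarrow> 'k::comm_ring_1 mpoly set" where
  "polys n = {f. \<forall>m \<in> Poly_Mapping.keys f. Poly_Mapping.keys m \<subseteq> {1..n}}"

text \<open>The ring homomorphism that is \<open>c\<close> on coefficients and sends the \<open>i\<close>-th variable to \<open>s i\<close>.\<close>

definition mpoly_hom ::
    "('k::comm_ring_1 \<Rightarrow> 'r::comm_ring_1) \<Rightarrow> (nat \<Rightarrow> 'r) \<Rightarrow> 'k mpoly \<Rightarrow> 'r" where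
  "mpoly_hom c s f =
     (\<Sum>m \<in> Poly_Mapping.keys f.
        c (Poly_Mapping.lookup f m) *
        (\<Prod>i \<in> Poly_Mapping.keys m. s i ^ Poly_Mapping.lookup m i))"

definition linear_representation ::
    "('g, 'z) monoid_scheme \<Rightarrow> ('k::field \<Rightarrow> 'v::ab_group_add \<Rightarrow> 'v) \<Rightarrow> ('g \<Rightarrow> 'v \<Rightarrow> 'v) \<Rightarrow> bool" where
  "linear_representation G scale \<rho> \<longleftrightarrow>
     group_action G UNIV \<rho> \<and> (\<forall>g \<in> carrier G. Vector_Spaces.linear scale scale (\<rho> g))"

definition subrepresentation ::
    "('g, 'z) monoid_scheme \<Rightarrow> ('k::field \<Rightarrow> 'v::ab_group_add \<Rightarrow> 'v) \<Rightarrow> ('g \<Rightarrow> 'v \<Rightarrow> 'v)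
       \<Rightarrow> 'v set \<Rightarrow> bool" where
  "subrepresentation G scale \<rho> A \<longleftrightarrow>
     module.subspace scale A \<and> (\<forall>g \<in> carrier G. \<forall>v \<in> A. \<rho> g v \<in> A)"

definition indecomposable ::
    "('g, 'z) monoid_scheme \<Rightarrow> ('k::field \<Rightarrow> 'v::ab_group_add \<Rightarrow> 'v) \<Rightarrow> ('g \<Rightarrow> 'v \<Rightarrow> 'v) \<Rightarrow> bool" where
  "indecomposable G scale \<rho> \<longleftrightarrow>
     (UNIV :: 'v set) \<noteq> {0} \<and>
     (\<forall>A B. subrepresentation G scale \<rho> A \<and> subrepresentation G scale \<rho> B \<and>
            A \<inter> B = {0} \<and> {a + b | a b. a \<in> A \<and> b \<in> B} = UNIV
            \<longrightarrow> A = {0} \<or> B = {0})"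

text \<open>\<open>x 1, \<dots>, x n\<close> is a basis of the dual space, so that the space has dimension \<open>n\<close>.
  The values \<open>x i\<close> for other \<open>i\<close> are irrelevant throughout.\<close>

definition coordinates ::
    "('k::field \<Rightarrow> 'v::ab_group_add \<Rightarrow> 'v) \<Rightarrow> nat \<Rightarrow> (nat \<Rightarrow> 'v \<Rightarrow> 'k) \<Rightarrow> bool" where
  "coordinates scale n x \<longleftrightarrow>
     (\<forall>i \<in> {1..n}. Vector_Spaces.linear scale (*) (x i)) \<and>
     bij_betw (\<lambda>v. \<lambda>i \<in> {1..n}. x i v) UNIV ({1..n} \<rightarrow>\<^sub>E UNIV)"

definition dual_basis :: "nat \<Rightarrow> (nat \<Rightarrow> 'v \<Rightarrow> 'k::field) \<Rightarrow> nat \<Rightarrow> 'v" where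
  "dual_basis n x j = (THE v. \<forall>i \<in> {1..n}. x i v = (if i = j then 1 else 0))"

text \<open>With respect to a coordinate system \<open>x\<close>, the ring \<open>k[V]\<close> is \<^term>\<open>polys n\<close>, the
  \<open>i\<close>-th variable standing for the coordinate function \<open>x i\<close>.\<close>

definition eval_at :: "(nat \<Rightarrow> 'v \<Rightarrow> 'k::field) \<Rightarrow> 'v \<Rightarrow> 'k mpoly \<Rightarrow> 'k" where
  "eval_at x v f = mpoly_hom (\<lambda>c. c) (\<lambda>i. x i v) f"

definition linear_form :: "nat \<Rightarrow> (nat \<Rightarrow> 'v \<Rightarrow> 'k::field) \<Rightarrow> ('v \<Rightarrow> 'k) \<Rightarrow> 'k mpoly" where
  "linear_form n x l = (\<Sum>j = 1..n. const (l (dual_basis n x j)) * var j)"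

text \<open>The action on \<open>k[V]\<close> by algebra automorphisms induced by \<open>g \<cdot> l = l \<circ> \<rho> (g\<^sup>-\<^sup>1)\<close> on linear
  forms, i.e. \<open>(g \<cdot> f) (v) = f (g\<^sup>-\<^sup>1 v)\<close>.\<close>

definition poly_action ::
    "('g, 'z) monoid_scheme \<Rightarrow> ('g \<Rightarrow> 'v \<Rightarrow> 'v) \<Rightarrow> nat \<Rightarrow> (nat \<Rightarrow> 'v \<Rightarrow> 'k::field)
       \<Rightarrow> 'g \<Rightarrow> 'k mpoly \<Rightarrow> 'k mpoly" where
  "poly_action G \<rho> n x g f =
     mpoly_hom const (\<lambda>i. linear_form n x (\<lambda>v. x i (\<rho> (inv\<^bsub>G\<^esub> g) v))) f"

definition invariants ::
    "('g, 'z) monoid_scheme \<Rightarrow> ('g \<Rightarrow> 'v \<Rightarrow> 'v) \<Rightarrow> nat \<Rightarrow> (nat \<Rightarrow> 'v \<Rightarrow> 'k::field) \<Rightarrow> 'k mpoly set" where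
  "invariants G \<rho> n x = {f \<in> polys n. \<forall>g \<in> carrier G. poly_action G \<rho> n x g f = f}"

definition separating_set ::
    "('g, 'z) monoid_scheme \<Rightarrow> ('g \<Rightarrow> 'v \<Rightarrow> 'v) \<Rightarrow> nat \<Rightarrow> (nat \<Rightarrow> 'v \<Rightarrow> 'k::field)
       \<Rightarrow> 'k mpoly set \<Rightarrow> bool" where
  "separating_set G \<rho> n x E \<longleftrightarrow>
     E \<subseteq> invariants G \<rho> n x \<and>
     (\<forall>v w. orbit G \<rho> v \<noteq> orbit G \<rho> w \<longrightarrow> (\<exists>h \<in> E. eval_at x v h \<noteq> eval_at x w h))"

text \<open>Below, \<open>G\<close> is meant to be cyclic of order \<open>p\<close> with generator \<open>\<sigma>\<close>.\<close>

definition poly_norm ::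
    "('g, 'z) monoid_scheme \<Rightarrow> ('g \<Rightarrow> 'v \<Rightarrow> 'v) \<Rightarrow> nat \<Rightarrow> (nat \<Rightarrow> 'v \<Rightarrow> 'k::field)
       \<Rightarrow> nat \<Rightarrow> 'g \<Rightarrow> 'k mpoly \<Rightarrow> 'k mpoly" where
  "poly_norm G \<rho> n x p \<sigma> f = (\<Prod>i = 0..<p. poly_action G \<rho> n x (\<sigma> [^]\<^bsub>G\<^esub> i) f)"

definition poly_trace ::
    "('g, 'z) monoid_scheme \<Rightarrow> ('g \<Rightarrow> 'v \<Rightarrow> 'v) \<Rightarrow> nat \<Rightarrow> (nat \<Rightarrow> 'v \<Rightarrow> 'k::field)
       \<Rightarrow> nat \<Rightarrow> 'g \<Rightarrow> 'k mpoly \<Rightarrow> 'k mpoly" where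
  "poly_trace G \<rho> n x p \<sigma> f = (\<Sum>i = 0..<p. poly_action G \<rho> n x (\<sigma> [^]\<^bsub>G\<^esub> i) f)"

definition array_positions :: "nat \<Rightarrow> (nat \<times> nat) set" where
  "array_positions n = {(i, j). 1 \<le> i \<and> i \<le> j \<and> j \<le> n - 1} \<union> {(n, n)}"

definition array_entry ::
    "('g, 'z) monoid_scheme \<Rightarrow> ('g \<Rightarrow> 'v \<Rightarrow> 'v) \<Rightarrow> nat \<Rightarrow> (nat \<Rightarrow> 'v \<Rightarrow> 'k::field)
       \<Rightarrow> nat \<Rightarrow> 'g \<Rightarrow> nat \<Rightarrow> nat \<Rightarrow> 'k mpoly" where
  "array_entry G \<rho> n x p \<sigma> i j =
     (if i = n \<and> j = n then var n ^ p
      else if i = j then poly_norm G \<rho> n x p \<sigma> (var i)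
      else poly_trace G \<rho> n x p \<sigma> (var i * var j ^ (p - 1)))"

definition diagonal_sum ::
    "('g, 'z) monoid_scheme \<Rightarrow> ('g \<Rightarrow> 'v \<Rightarrow> 'v) \<Rightarrow> nat \<Rightarrow> (nat \<Rightarrow> 'v \<Rightarrow> 'k::field)
       \<Rightarrow> nat \<Rightarrow> 'g \<Rightarrow> nat \<Rightarrow> 'k mpoly" where
  "diagonal_sum G \<rho> n x p \<sigma> k =
     (\<Sum>(i, j) \<in> {(i, j) \<in> array_positions n. i + j = k}. array_entry G \<rho> n x p \<sigma> i j)"

text \<open>For \<open>n = 1\<close> the range \<open>{2..2 * n - 2}\<close> is empty.\<close>

definition diagonal_sums ::
    "('g, 'z) monoid_scheme \<Rightarrow> ('g \<Rightarrow> 'v \<Rightarrow> 'v) \<Rightarrow> nat \<Rightarrow> (nat \<Rightarrow> 'v \<Rightarrow> 'k::field)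
       \<Rightarrow> nat \<Rightarrow> 'g \<Rightarrow> 'k mpoly set" where
  "diagonal_sums G \<rho> n x p \<sigma> =
     diagonal_sum G \<rho> n x p \<sigma> ` {2..2 * n - 2} \<union> {var n ^ p}"

end

theory Submission
  imports Defs "HOL-Algebra.Multiplicative_Group" "HOL-Computational_Algebra.Primes"
begin

text \<open>In coordinates the inverse of \<open>\<sigma>\<close> acts on points by \<open>T: a\<^sub>i \<mapsto> a\<^sub>i + a\<^sub>i\<^sub>+\<^sub>1\<close>. Suppose that all diagonal
  sums and \<open>x\<^sub>n\<^sup>p\<close> agree at \<open>a\<close> and \<open>b\<close>, and let \<open>m\<close> be the last index with \<open>a\<^sub>m \<noteq> 0\<close> or \<open>b\<^sub>m \<noteq> 0\<close>.
  On vectors supported on \<open>{1..m}\<close> the entries \<open>u\<^sub>i\<^sub>j\<close> with \<open>i < j\<close> and \<open>j > m\<close> vanish, and so do those with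
  \<open>i < j = m < p\<close>, where \<open>x\<^sub>m\<close> is constant on orbits and the trace of \<open>x\<^sub>i\<close> is zero.
  Hence diagonal \<open>2m\<close> reduces to \<open>x\<^sub>m\<^sup>p\<close> (for \<open>m = n\<close> use \<open>x\<^sub>n\<^sup>p\<close> instead), giving \<open>a\<^sub>m = b\<^sub>m\<close>; diagonal
  \<open>2m - 2\<close> reduces to the norm of \<open>x\<^sub>m\<^sub>-\<^sub>1\<close>, whose fibre is a single orbit on the last two coordinates, so
  after applying a power of \<open>T\<close> also \<open>a\<^sub>m\<^sub>-\<^sub>1 = b\<^sub>m\<^sub>-\<^sub>1\<close>. For \<open>i = m - 2, \<dots>, 1\<close>, once \<open>a\<close> and \<open>b\<close> agree beyond
  \<open>i\<close>, diagonal \<open>i + m - 1\<close> gives \<open>(a\<^sub>i - b\<^sub>i) Tr (x\<^sub>m\<^sub>-\<^sub>1\<^sup>p\<^sup>-\<^sup>1) = 0\<close>, and this trace is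
  \<open>- a\<^sub>m\<^sup>p\<^sup>-\<^sup>1 \<noteq> 0\<close>.\<close>

section \<open>The shift operator on coordinate sequences\<close>

text \<open>Sequences stand for coordinate vectors padded by zeros on the right, so the last
  coordinate needs no separate rule. Index 0 carries no coordinate.\<close>

definition shift_add :: "(nat \<Rightarrow> 'k::semiring_1) \<Rightarrow> nat \<Rightarrow> 'k" where
  "shift_add a i = a i + a (Suc i)"

lemma funpow_Suc_shift_add:
  "(shift_add ^^ Suc l) a i = (shift_add ^^ l) a i + (shift_add ^^ l) a (Suc i)"
  using shift_add_def[of "(shift_add ^^ l) a" i] by simp

text \<open>The binomial theorem for \<open>T = 1 + S\<close>, where \<open>S\<close> drops the
  first entry.\<close>

lemma funpow_shift_add:
  "(shift_add ^^ l) a i = (\<Sum>r\<le>l. of_nat (l choose r) * a (i + r))"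
proof (induction l arbitrary: i)
  case (Suc l)
  have "(shift_add ^^ Suc l) a i =
      (\<Sum>r\<le>l. of_nat (l choose r) * a (i + r)) + (\<Sum>r\<le>l. of_nat (l choose r) * a (i + Suc r))"
    by (simp add: funpow_Suc_shift_add Suc.IH del: funpow.simps)
  also have "(\<Sum>r\<le>l. of_nat (l choose r) * a (i + r)) =
      a i + (\<Sum>r\<le>l. of_nat (l choose Suc r) * a (i + Suc r))"
    using sum.atMost_Suc_shift[of "\<lambda>r. of_nat (l choose r) * a (i + r)" l]
    by (simp add: binomial_eq_0)
  finally show ?case
    by (subst sum.atMost_Suc_shift) (simp add: sum.distrib algebra_simps)
qed simp

lemma funpow_shift_add_cong:
  assumes "\<And>j. i \<le> j \<Longrightarrow> a j = b j"
  shows "(shift_add ^^ l) a i = (shift_add ^^ l) b i"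
  using assms by (simp add: funpow_shift_add)

lemma funpow_shift_add_eq_0:
  assumes "\<And>j. i \<le> j \<Longrightarrow> a j = 0"
  shows "(shift_add ^^ l) a i = 0"
  using assms by (simp add: funpow_shift_add)

text \<open>\<open>a - b\<close> vanishes beyond \<open>i\<close>, so each application of
  \<open>T\<close> adds zero to its entry at \<open>i\<close>.\<close>

lemma funpow_shift_add_diff:
  fixes a b :: "nat \<Rightarrow> 'k::ring_1"
  assumes "\<And>j. i < j \<Longrightarrow> a j = b j"
  shows "(shift_add ^^ l) a i - (shift_add ^^ l) b i = a i - b i"
proof (induction l)
  case (Suc l)
  have "(shift_add ^^ l) a (Suc i) = (shift_add ^^ l) b (Suc i)"
    using assms by (intro funpow_shift_add_cong) auto
  with Suc show ?case
    by (simp add: funpow_Suc_shift_add algebra_simps del: funpow.simps)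
qed simp

lemma funpow_shift_add_last:
  fixes a :: "nat \<Rightarrow> 'k::ring_1"
  assumes "\<And>j. m < j \<Longrightarrow> a j = 0"
  shows "(shift_add ^^ l) a m = a m"
  using funpow_shift_add_diff[of m a "\<lambda>_. 0" l] funpow_shift_add_eq_0[of m "\<lambda>_. 0 :: 'k" l] assms
  by simp

lemma funpow_shift_add_penultimate:
  fixes a :: "nat \<Rightarrow> 'k::ring_1"
  assumes "\<And>j. Suc m < j \<Longrightarrow> a j = 0"
  shows "(shift_add ^^ l) a m = a m + of_nat l * a (Suc m)"
proof (induction l)
  case (Suc l)
  have "(shift_add ^^ l) a (Suc m) = a (Suc m)"
    using assms by (rule funpow_shift_add_last)
  with Suc show ?case
    by (simp add: funpow_Suc_shift_add algebra_simps del: funpow.simps)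
qed simp

lemma funpow_shift_add_shifted:
  "(shift_add ^^ l) (\<lambda>j. a (j - 1)) (Suc i) = (shift_add ^^ l) a i"
  by (simp add: funpow_shift_add)

text \<open>For \<open>0 < r < p\<close> the coefficient \<open>p choose r\<close> is zero in
  characteristic \<open>p\<close>, and the term \<open>r = p\<close> lies outside the
  support.\<close>

lemma funpow_shift_add_char:
  fixes a :: "nat \<Rightarrow> 'k::comm_ring_1"
  assumes "CHAR('k) = p" "prime p" "\<And>j. i + p \<le> j \<Longrightarrow> a j = 0"
  shows "(shift_add ^^ p) a i = a i"
proof -
  have "(shift_add ^^ p) a i = (\<Sum>r\<in>{0}. of_nat (p choose r) * a (i + r))"
    unfolding funpow_shift_add
  proof (rule sum.mono_neutral_right; (intro ballI)?)
    fix r assume r: "r \<in> {..p} - {0}"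
    show "of_nat (p choose r) * a (i + r) = 0"
    proof (cases "r = p")
      case False
      then have "p dvd (p choose r)"
        using r assms(2) by (intro dvd_choose_prime) auto
      then have "of_nat (p choose r) = (0 :: 'k)"
        using assms(1) by (simp add: of_nat_eq_0_iff_char_dvd)
      then show ?thesis by simp
    qed (simp add: assms(3))
  qed auto
  then show ?thesis by simp
qed

text \<open>\<open>T - 1\<close> is the shift, so \<open>a\<close> is \<open>(T - 1) a'\<close> for
  a copy \<open>a'\<close> of \<open>a\<close> moved up by one index, and the sum
  telescopes.\<close>

lemma sum_funpow_shift_add_eq_0:
  fixes a :: "nat \<Rightarrow> 'k::comm_ring_1"
  assumes "CHAR('k) = p" "prime p" "i \<ge> 1" "\<And>j. p \<le> j \<Longrightarrow> a j = 0"
  shows "(\<Sum>l<p. (shift_add ^^ l) a i) = 0"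
proof -
  define a' where "a' = (\<lambda>j. a (j - 1))"
  have "(\<Sum>l<p. (shift_add ^^ l) a i) = (\<Sum>l<p. (shift_add ^^ Suc l) a' i - (shift_add ^^ l) a' i)"
    using assms(3) unfolding a'_def
    by (intro sum.cong) (simp_all add: funpow_Suc_shift_add funpow_shift_add_shifted[simplified] del: funpow.simps)
  also have "\<dots> = (shift_add ^^ p) a' i - a' i"
    by (subst sum_lessThan_telescope) simp
  \<comment> \<open>The support of \<open>a'\<close> may reach index \<open>p\<close>;
    \<open>i \<ge> 1\<close> makes up for this.\<close>
  also have "(shift_add ^^ p) a' i = a' i"
    using assms by (intro funpow_shift_add_char) (auto simp: a'_def)
  finally show ?thesis by simp
qed

section \<open>Arithmetic of the prime field in characteristic p\<close>

lemma of_nat_power_char: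
  assumes "CHAR('k::comm_ring_1) = p" "prime p"
  shows "of_nat l ^ p = (of_nat l :: 'k)"
proof (induction l)
  case 0
  then show ?case using prime_gt_0_nat[OF assms(2)] by (simp add: zero_power)
next
  case (Suc l)
  have "prime CHAR('k)"
    using assms by simp
  then have "(1 + of_nat l :: 'k) ^ p = 1 ^ p + of_nat l ^ p"
    using assms(1) by (intro freshmans_dream) simp_all
  then show ?case
    by (simp add: Suc)
qed

lemma inj_on_of_nat_char: "inj_on (of_nat :: nat \<Rightarrow> 'k::comm_ring_1) {..<CHAR('k)}"
proof -
  have *: "l = l'" if "l \<le> l'" "l' < CHAR('k)" "of_nat l = (of_nat l' :: 'k)" for l l'
  proof -
    have "of_nat (l' - l) = (0 :: 'k)"
      using that by (simp add: of_nat_diff)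
    then have "CHAR('k) dvd l' - l"
      by (simp only: of_nat_eq_0_iff_char_dvd)
    then show ?thesis
      using that by (auto dest: dvd_imp_le)
  qed
  show ?thesis
    by (rule inj_onI) (metis * lessThan_iff nat_le_linear)
qed

lemma of_nat_power_char_minus_1:
  assumes "CHAR('k::field) = p" "prime p" "0 < l" "l < p"
  shows "of_nat l ^ (p - 1) = (1 :: 'k)"
proof -
  have "\<not> p dvd l"
    using assms by (auto dest: dvd_imp_le)
  then have "of_nat l \<noteq> (0 :: 'k)"
    using assms by (simp add: of_nat_eq_0_iff_char_dvd)
  moreover have "of_nat l * of_nat l ^ (p - 1) = (of_nat l :: 'k)"
    using of_nat_power_char[of p l, where 'k = 'k] assms
    by (metis gr_zeroI not_less_zero power_eq_if)
  ultimately show ?thesis by simp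
qed

text \<open>Both sides are polynomials of degree less than \<open>p\<close> in \<open>c\<close> that agree on the prime field.\<close>

lemma sum_add_of_nat_power:
  fixes c :: "'k::field"
  assumes "CHAR('k) = p" "prime p"
  shows "(\<Sum>l<p. (c + of_nat l) ^ (p - 1)) = - 1"
proof -
  have p: "p > 0" using assms(2) by (rule prime_gt_0_nat)
  have p0: "of_nat p = (0 :: 'k)" using assms(1) by (simp add: of_nat_eq_0_iff_char_dvd)
  define q :: "'k poly" where "q = (\<Sum>l<p. [:of_nat l, 1:] ^ (p - 1))"
  have poly_q: "poly q y = (\<Sum>l<p. (y + of_nat l) ^ (p - 1))" for y
    by (simp add: q_def poly_sum poly_power add.commute)
  have card: "card (of_nat ` {..<p} :: 'k set) = p"
    using inj_on_of_nat_char[where 'k = 'k] assms(1) by (simp add: card_image)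
  have "poly q (of_nat k) = - 1" for k
  proof (induction k)
    case 0
    have "(\<Sum>l<p. of_nat l ^ (p - 1)) = (\<Sum>l\<in>{..<p} - {0}. of_nat l ^ (p - 1) :: 'k)"
      using prime_gt_1_nat[OF assms(2)]
      by (intro sum.mono_neutral_right) (auto simp: zero_power)
    also have "\<dots> = (\<Sum>l\<in>{..<p} - {0}. 1)"
      using of_nat_power_char_minus_1[OF assms] by (intro sum.cong) auto
    also have "\<dots> = - 1"
      using p p0 by (simp add: of_nat_diff)
    finally show ?case by (simp add: poly_q)
  next
    case (Suc k)
    \<comment> \<open>Passing from \<open>k\<close> to \<open>k + 1\<close> replaces the term at
      \<open>l = 0\<close> by the one at \<open>l = p\<close>; they agree because \<open>p\<close>
      is zero in the field.\<close>
    have "(\<Sum>l<p. (of_nat k + of_nat (Suc l) :: 'k) ^ (p - 1)) = (\<Sum>l<p. (of_nat k + of_nat l) ^ (p - 1))"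
      using sum_lessThan_telescope[of "\<lambda>l. (of_nat k + of_nat l :: 'k) ^ (p - 1)" p] p0
      by (simp only: sum_subtractf) simp
    then show ?case using Suc by (simp add: poly_q add_ac)
  qed
  moreover have "degree q \<le> p - 1"
    unfolding q_def by (intro degree_sum_le) (auto intro: order.trans[OF degree_power_le])
  ultimately have "q = [:- 1:]"
    using p card by (intro poly_eqI_degree[of "of_nat ` {..<p}"]) auto
  then show ?thesis
    using poly_q[of c] by simp
qed

text \<open>Both sides are monic polynomials of degree \<open>p\<close> in \<open>c\<close> that
  vanish on the \<open>p\<close> elements of the prime field.\<close>

lemma prod_add_of_nat:
  fixes c :: "'k::field"
  assumes "CHAR('k) = p" "prime p"
  shows "(\<Prod>l<p. c + of_nat l) = c ^ p - c"
proof -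
  have p: "p > 1" using assms(2) by (rule prime_gt_1_nat)
  have p0: "of_nat p = (0 :: 'k)" using assms(1) by (simp add: of_nat_eq_0_iff_char_dvd)
  define q :: "'k poly" where "q = (\<Prod>l<p. [:of_nat l, 1:])"
  define r :: "'k poly" where "r = Polynomial.monom 1 p - Polynomial.monom 1 1"
  have card: "card (of_nat ` {..<p} :: 'k set) = p"
    using inj_on_of_nat_char[where 'k = 'k] assms(1) by (simp add: card_image)
  have deg: "degree q = p"
    by (simp add: q_def degree_prod_eq_sum_degree)
  have "lead_coeff q = (\<Prod>l<p. lead_coeff [:of_nat l, 1 :: 'k:])"
    unfolding q_def by (rule lead_coeff_prod)
  then have coeff: "poly.coeff q p = 1"
    by (simp add: deg)
  have "degree r \<le> p"
    using p unfolding r_def by (intro degree_diff_le) (auto simp: degree_monom_eq)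
  have "poly.coeff r p = 1"
    using p by (simp add: r_def)
  have "poly q (of_nat k) = 0" if "k < p" for k
  proof -
    have "of_nat k + of_nat (if k = 0 then 0 else p - k) = (0 :: 'k)"
      using that p0 by (simp add: of_nat_diff)
    then show ?thesis
      using p by (auto simp: q_def poly_prod add.commute intro!: bexI[of _ "if k = 0 then 0 else p - k"])
  qed
  moreover have "poly r (of_nat k) = 0" for k
    using of_nat_power_char[OF assms] by (simp add: r_def poly_monom)
  ultimately have "q = r"
    using deg coeff card \<open>degree r \<le> p\<close> \<open>poly.coeff r p = 1\<close>
    by (intro poly_eqI_degree_lead_coeff[of q p r "of_nat ` {..<p}"]) auto
  moreover have "poly q c = (\<Prod>l<p. c + of_nat l)" "poly r c = c ^ p - c"
    by (simp_all add: q_def r_def poly_prod poly_monom add.commute)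
  ultimately show ?thesis by simp
qed

text \<open>Injectivity of Frobenius: it is additive, and a field has no nonzero nilpotents.\<close>

lemma power_char_inj:
  fixes x y :: "'k::field"
  assumes "CHAR('k) = p" "prime p" "x ^ p = y ^ p"
  shows "x = y"
proof -
  have "(x - y + y) ^ p = (x - y) ^ p + y ^ p"
    using assms by (intro freshmans_dream) auto
  then show ?thesis
    using assms(3) by simp
qed

text \<open>Both products equal \<open>b ^ p * (X ^ p - X)\<close> at \<open>X = x / b\<close> and \<open>X = y / b\<close>.\<close>

lemma prod_add_of_nat_mult_eqD:
  fixes b x y :: "'k::field"
  assumes "CHAR('k) = p" "prime p" "b \<noteq> 0"
    and eq: "(\<Prod>l<p. x + of_nat l * b) = (\<Prod>l<p. y + of_nat l * b)"
  obtains l where "y = x + of_nat l * b"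
proof -
  have scaled: "(\<Prod>l<p. z + of_nat l * b) = b ^ p * ((z / b) ^ p - z / b)" for z
  proof -
    have "(\<Prod>l<p. z + of_nat l * b) = (\<Prod>l<p. b * (z / b + of_nat l))"
      using assms(3) by (intro prod.cong) (auto simp: field_simps)
    then show ?thesis
      by (simp add: prod.distrib prod_add_of_nat[OF assms(1,2)])
  qed
  \<comment> \<open>\<open>X^p - X\<close> is additive, so \<open>u\<close> lies in its kernel, the
    prime field; \<open>l\<close> is read off from the vanishing factor of the product.\<close>
  define u where "u = x / b - y / b"
  have "(u + y / b) ^ p = u ^ p + (y / b) ^ p"
    using assms by (intro freshmans_dream) auto
  then have "u ^ p - u = 0"
    using eq assms(3) by (simp add: scaled) (simp add: u_def algebra_simps)
  then have "(\<Prod>l<p. u + of_nat l) = 0"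
    by (simp add: prod_add_of_nat[OF assms(1,2)])
  then obtain l where "u + of_nat l = 0"
    by auto
  then have "y = x + of_nat l * b"
    using assms(3) by (simp add: u_def field_simps)
  then show thesis by (rule that)
qed

section \<open>Entries of the array at a point\<close>

text \<open>Here and in the next definition: values of array entries at a point \<open>v\<close>
  with coordinates \<open>a\<close>. As \<open>\<sigma>\<close> acts on functions through its
  inverse on points, \<open>(\<sigma>^l x_i)(v)\<close> is entry \<open>i\<close> of
  \<open>T^l a\<close>.\<close>

definition norm_val :: "nat \<Rightarrow> nat \<Rightarrow> (nat \<Rightarrow> 'k::comm_ring_1) \<Rightarrow> 'k" where
  "norm_val p i a = (\<Prod>l<p. (shift_add ^^ l) a i)"

definition trace_val :: "nat \<Rightarrow> nat \<Rightarrow> nat \<Rightarrow> (nat \<Rightarrow> 'k::comm_ring_1) \<Rightarrow> 'k" where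
  "trace_val p i j a = (\<Sum>l<p. (shift_add ^^ l) a i * (shift_add ^^ l) a j ^ (p - 1))"

definition entry_val :: "nat \<Rightarrow> nat \<Rightarrow> nat \<Rightarrow> (nat \<Rightarrow> 'k::comm_ring_1) \<Rightarrow> 'k" where
  "entry_val p i j a = (if i = j then norm_val p i a else trace_val p i j a)"

text \<open>The position \<open>(n, n)\<close> is absent: it lies on diagonal \<open>2 * n\<close>,
  and \<open>x_n^p\<close> is carried along separately.\<close>

definition diagonal :: "nat \<Rightarrow> nat \<Rightarrow> (nat \<times> nat) set" where
  "diagonal n k = {(i, j). 1 \<le> i \<and> i \<le> j \<and> j \<le> n - 1 \<and> i + j = k}"

lemma finite_diagonal: "finite (diagonal n k)"
  by (rule finite_subset[of _ "{..k} \<times> {..k}"]) (auto simp: diagonal_def)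

text \<open>Replacing \<open>a\<close> by \<open>T a\<close> moves the index \<open>l\<close> up by
  one, and the wrap-around term agrees because \<open>T^p\<close> fixes all positive
  positions.\<close>

lemma entry_val_shift_add:
  fixes a :: "nat \<Rightarrow> 'k::comm_ring_1"
  assumes "CHAR('k) = p" "prime p" "1 \<le> i" "i \<le> j" "\<And>j. p < j \<Longrightarrow> a j = 0"
  shows "entry_val p i j (shift_add a) = entry_val p i j a"
proof -
  have funpow: "(shift_add ^^ l) (shift_add a) = (shift_add ^^ Suc l) a" for l
    by (simp add: funpow_swap1)
  have closed: "(shift_add ^^ p) a i' = a i'" if "1 \<le> i'" for i'
    using assms that by (intro funpow_shift_add_char) auto
  obtain q where q: "p = Suc q"
    using prime_gt_0_nat[OF assms(2)] gr0_implies_Suc by blast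
  have "(\<Prod>l<p. (shift_add ^^ Suc l) a i) = (\<Prod>l<p. (shift_add ^^ l) a i)"
  proof -
    define h where "h = (\<lambda>l. (shift_add ^^ l) a i)"
    have "(\<Prod>l<p. h (Suc l)) = (\<Prod>l<q. h (Suc l)) * h p"
      by (simp add: q)
    moreover have "(\<Prod>l<p. h l) = h 0 * (\<Prod>l<q. h (Suc l))"
      unfolding q by (rule prod.lessThan_Suc_shift)
    moreover have "h p = h 0"
      using closed assms(3) by (simp add: h_def)
    ultimately show ?thesis
      unfolding h_def by (simp only: mult.commute)
  qed
  moreover have "(\<Sum>l<p. (shift_add ^^ Suc l) a i * (shift_add ^^ Suc l) a j ^ (p - 1)) =
      (\<Sum>l<p. (shift_add ^^ l) a i * (shift_add ^^ l) a j ^ (p - 1))"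
  proof -
    define h where "h = (\<lambda>l. (shift_add ^^ l) a i * (shift_add ^^ l) a j ^ (p - 1))"
    have "(\<Sum>l<p. h (Suc l)) - (\<Sum>l<p. h l) = h p - h 0"
      by (simp only: sum_subtractf[symmetric] sum_lessThan_telescope)
    moreover have "h p = h 0"
      using closed assms(3,4) by (simp add: h_def)
    ultimately show ?thesis
      unfolding h_def by simp
  qed
  ultimately show ?thesis
    by (simp only: entry_val_def norm_val_def trace_val_def funpow)
qed

lemma entry_val_cong:
  assumes "i \<le> j" "\<And>i'. i \<le> i' \<Longrightarrow> a i' = b i'"
  shows "entry_val p i j a = entry_val p i j b"
proof -
  have "(shift_add ^^ l) a i = (shift_add ^^ l) b i" "(shift_add ^^ l) a j = (shift_add ^^ l) b j" for l
    using assms by (auto intro: funpow_shift_add_cong)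
  then show ?thesis
    by (simp add: entry_val_def norm_val_def trace_val_def)
qed

text \<open>As \<open>a\<close> vanishes beyond \<open>j\<close>, the entry is \<open>a j ^ (p - 1)\<close> times the trace of a coordinate,
  and that trace is zero because \<open>j < p\<close>.\<close>

lemma entry_val_eq_0:
  fixes a :: "nat \<Rightarrow> 'k::comm_ring_1"
  assumes "CHAR('k) = p" "prime p" "1 \<le> i" "i < j" "m \<le> j" "j < p" "\<And>j. m < j \<Longrightarrow> a j = 0"
  shows "entry_val p i j a = 0"
proof -
  have zero: "a j' = 0" if "j < j'" for j'
    using that assms(5,7) by simp
  have "trace_val p i j a = (\<Sum>l<p. (shift_add ^^ l) a i) * a j ^ (p - 1)"
    using funpow_shift_add_last[of j a, OF zero] by (simp add: trace_val_def sum_distrib_right)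
  also have "(\<Sum>l<p. (shift_add ^^ l) a i) = 0"
    using assms by (intro sum_funpow_shift_add_eq_0) auto
  finally show ?thesis
    using assms(4) by (simp add: entry_val_def)
qed

text \<open>The device that reduces a diagonal to one entry: the terms known to agree
  cancel.\<close>

lemma entry_val_eq_if_diagonal_eq:
  assumes "(\<Sum>(i, j)\<in>diagonal n k. entry_val p i j a) = (\<Sum>(i, j)\<in>diagonal n k. entry_val p i j b)"
    and "(i, j) \<in> diagonal n k"
    and "\<And>i' j'. (i', j') \<in> diagonal n k \<Longrightarrow> (i', j') \<noteq> (i, j) \<Longrightarrow> entry_val p i' j' a = entry_val p i' j' b"
  shows "entry_val p i j a = entry_val p i j b"
proof -
  have "(\<Sum>(i, j)\<in>diagonal n k - {(i, j)}. entry_val p i j a) = (\<Sum>(i, j)\<in>diagonal n k - {(i, j)}. entry_val p i j b)"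
    using assms(3) by (intro sum.cong) auto
  then show ?thesis
    using assms(1,2) by (simp add: sum.remove[OF finite_diagonal assms(2)])
qed

text \<open>Under powers of \<open>T\<close>, column \<open>Suc m\<close> runs through an arithmetic
  progression common to \<open>a\<close> and \<open>b\<close>, while the difference at
  \<open>i\<close> stays constant. So the traces differ by \<open>a i - b i\<close> times a nonzero
  power sum.\<close>

lemma entry_val_inj_below_penultimate:
  fixes a b :: "nat \<Rightarrow> 'k::field"
  assumes "CHAR('k) = p" "prime p" "i \<le> m"
    and "a (Suc (Suc m)) \<noteq> 0" "\<And>j. Suc (Suc m) < j \<Longrightarrow> a j = 0"
    and "\<And>j. i < j \<Longrightarrow> a j = b j"
    and eq: "entry_val p i (Suc m) a = entry_val p i (Suc m) b"
  shows "a i = b i"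
proof -
  define c d where "c = a (Suc m)" and "d = a (Suc (Suc m))"
  have b_eq: "(shift_add ^^ l) b (Suc m) = (shift_add ^^ l) a (Suc m)" for l
    using assms(3,6) by (intro funpow_shift_add_cong) auto
  have pen: "(shift_add ^^ l) a (Suc m) = c + of_nat l * d" for l
    using assms(5) unfolding c_def d_def by (intro funpow_shift_add_penultimate) auto
  have "0 = trace_val p i (Suc m) a - trace_val p i (Suc m) b"
    using eq assms(3) by (simp add: entry_val_def)
  also have "\<dots> = (\<Sum>l<p. ((shift_add ^^ l) a i - (shift_add ^^ l) b i) * (c + of_nat l * d) ^ (p - 1))"
    by (simp add: trace_val_def b_eq pen sum_subtractf left_diff_distrib)
  also have "\<dots> = (a i - b i) * (\<Sum>l<p. (c + of_nat l * d) ^ (p - 1))"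
    using funpow_shift_add_diff[of i a b] assms(6) by (simp add: sum_distrib_left)
  \<comment> \<open>Pulling out \<open>d ^ (p - 1)\<close> leaves the power sum over
    \<open>c / d + l\<close>, which is \<open>- 1\<close>.\<close>
  also have "(\<Sum>l<p. (c + of_nat l * d) ^ (p - 1)) = (\<Sum>l<p. d ^ (p - 1) * (c / d + of_nat l) ^ (p - 1))"
    using assms(4) by (intro sum.cong) (auto simp: d_def field_simps simp flip: power_mult_distrib)
  also have "\<dots> = - (d ^ (p - 1))"
    unfolding sum_distrib_left[symmetric] sum_add_of_nat_power[OF assms(1,2)] by simp
  finally show ?thesis
    using assms(4) by (simp add: d_def)
qed

text \<open>One exponent \<open>l\<close> has to serve for all coordinates. It is chosen at the
  coordinate before the last nonzero one and then shown to work below it.\<close>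

lemma diagonal_coincidence_imp_same_orbit:
  fixes a b :: "nat \<Rightarrow> 'k::field"
  assumes char: "CHAR('k) = p" "prime p" and n: "n \<le> p"
    and zero: "\<And>j. n < j \<Longrightarrow> a j = 0" "\<And>j. n < j \<Longrightarrow> b j = 0"
    and diag: "\<And>k. k \<in> {2..2 * n - 2} \<Longrightarrow>
      (\<Sum>(i, j)\<in>diagonal n k. entry_val p i j a) = (\<Sum>(i, j)\<in>diagonal n k. entry_val p i j b)"
    and last: "a n ^ p = b n ^ p"
  shows "\<exists>l. \<forall>i\<ge>1. b i = (shift_add ^^ l) a i"
proof -
  have top: "a m = b m" if "1 \<le> m" and above: "\<And>j. m < j \<Longrightarrow> a j = 0 \<and> b j = 0" for m
  proof (cases m n rule: linorder_cases)
    case less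
    \<comment> \<open>The other positions on this diagonal have \<open>i < m < j < p\<close>, so
      their traces vanish for both vectors.\<close>
    have "entry_val p m m a = entry_val p m m b"
    proof (rule entry_val_eq_if_diagonal_eq[OF diag[of "2 * m"]])
      fix i j assume "(i, j) \<in> diagonal n (2 * m)" "(i, j) \<noteq> (m, m)"
      then have "1 \<le> i" "i < j" "m \<le> j" "j < p"
        using n less by (auto simp: diagonal_def)
      then show "entry_val p i j a = entry_val p i j b"
        using char above by (simp add: entry_val_eq_0[of p i j m])
    qed (use that less in \<open>auto simp: diagonal_def\<close>)
    then have "a m ^ p = b m ^ p"
      using above by (simp add: entry_val_def norm_val_def funpow_shift_add_last)
    then show ?thesis
      using char by (rule power_char_inj[rotated 2])
  next
    case equal
    then show ?thesis using last char power_char_inj by blast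
  qed (use zero in simp)
  show ?thesis
  proof (cases "\<forall>i\<ge>1. a i = 0 \<and> b i = 0")
    case True
    then show ?thesis by (intro exI[of _ 0]) simp
  next
    case False
    \<comment> \<open>The joint support is used because \<open>a\<close> and \<open>b\<close> are
      not yet known to end at the same index; \<open>top\<close> shows that they do.\<close>
    define M where "M = {i. 1 \<le> i \<and> (a i \<noteq> 0 \<or> b i \<noteq> 0)}"
    define m where "m = Max M"
    have "M \<subseteq> {..n}"
      using zero by (auto simp: M_def not_le[symmetric])
    then have "finite M"
      using finite_subset by blast
    moreover have "M \<noteq> {}"
      using False by (auto simp: M_def)
    ultimately have "m \<in> M" and le_m: "\<And>j. j \<in> M \<Longrightarrow> j \<le> m"
      by (auto simp: m_def)
    have above: "a j = 0 \<and> b j = 0" if "m < j" for j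
      using le_m[of j] that by (auto simp: M_def)
    have m: "1 \<le> m" "m \<le> n"
      using \<open>m \<in> M\<close> \<open>M \<subseteq> {..n}\<close> by (auto simp: M_def)
    have am: "a m = b m"
      using m above by (intro top) auto
    have "a m \<noteq> 0"
      using \<open>m \<in> M\<close> am by (auto simp: M_def)
    \<comment> \<open>For \<open>m = 1\<close> there is no earlier coordinate. Otherwise
      \<open>Suc m0\<close> is the index before the last, written without subtraction.\<close>
    consider "m = 1" | m0 where "m = Suc (Suc m0)"
      using m(1) by (metis One_nat_def not0_implies_Suc not_one_le_zero)
    then show ?thesis
    proof cases
      case 1
      have "b i = a i" if "i \<ge> 1" for i
        using that above[of i] am 1 by (cases "i = 1") auto
      then show ?thesis by (intro exI[of _ 0]) simp
    next
      case 2
      \<comment> \<open>Off the centre of this diagonal \<open>j \<ge> m\<close>, so only the norm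
        of the penultimate coordinate survives.\<close>
      have "entry_val p (Suc m0) (Suc m0) a = entry_val p (Suc m0) (Suc m0) b"
      proof (rule entry_val_eq_if_diagonal_eq[OF diag[of "2 * m - 2"]])
        fix i j assume "(i, j) \<in> diagonal n (2 * m - 2)" "(i, j) \<noteq> (Suc m0, Suc m0)"
        then have "1 \<le> i" "i < j" "m \<le> j" "j < p"
          using n m 2 by (auto simp: diagonal_def)
        then show "entry_val p i j a = entry_val p i j b"
          using char above by (simp add: entry_val_eq_0[of p i j m])
      qed (use m 2 in \<open>auto simp: diagonal_def\<close>)
      then have "(\<Prod>l<p. a (Suc m0) + of_nat l * a m) = (\<Prod>l<p. b (Suc m0) + of_nat l * a m)"
        using above 2 am by (simp add: entry_val_def norm_val_def funpow_shift_add_penultimate)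
      then obtain l where l: "b (Suc m0) = a (Suc m0) + of_nat l * a m"
        using prod_add_of_nat_mult_eqD[OF char \<open>a m \<noteq> 0\<close>] by metis
      define a' where "a' = (shift_add ^^ l) a"
      have above': "a' j = 0" if "m < j" for j
        using that above unfolding a'_def by (intro funpow_shift_add_eq_0) auto
      have a'm: "a' m = a m"
        using above unfolding a'_def by (intro funpow_shift_add_last) auto
      have a'm0: "a' (Suc m0) = b (Suc m0)"
        using above 2 unfolding a'_def l by (simp add: funpow_shift_add_penultimate)
      \<comment> \<open>Invariance carries the diagonal equations from \<open>a\<close> to its
        translate \<open>a'\<close>, which replaces \<open>a\<close> from here on.\<close>
      have entry': "entry_val p i j a' = entry_val p i j a" if "1 \<le> i" "i \<le> j" for i j
      proof -
        have "entry_val p i j ((shift_add ^^ l') a) = entry_val p i j a" for l'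
        proof (induction l')
          case (Suc l')
          have "(shift_add ^^ l') a j' = 0" if "p < j'" for j'
            using that zero n by (intro funpow_shift_add_eq_0) auto
          then show ?case
            using Suc char that by (simp add: entry_val_shift_add)
        qed simp
        then show ?thesis by (simp add: a'_def)
      qed
      have agree: "a' j = b j" if "m0 < j" for j
      proof -
        consider "j = Suc m0" | "j = m" | "m < j"
          using \<open>m0 < j\<close> 2 by linarith
        then show ?thesis
          using a'm0 a'm am above' above by cases auto
      qed
      \<comment> \<open>Downward induction from \<open>Suc m0\<close>; the claim covers all later
        indices so that the step knows everything beyond \<open>i\<close>.\<close>
      have "\<forall>j\<ge>i. a' j = b j" if "1 \<le> i" "i \<le> Suc m0" for i
        using that(2,1)
      proof (induction i rule: inc_induct)
        case base
        then show ?case using agree by simp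
      next
        case (step i)
        then have IH: "a' j = b j" if "i < j" for j
          using that by simp
        have "entry_val p i (Suc m0) a' = entry_val p i (Suc m0) b"
        proof (rule entry_val_eq_if_diagonal_eq)
          have "(\<Sum>(i, j)\<in>diagonal n (i + Suc m0). entry_val p i j a') =
              (\<Sum>(i, j)\<in>diagonal n (i + Suc m0). entry_val p i j a)"
            by (rule sum.cong) (auto simp: diagonal_def entry')
          then show "(\<Sum>(i, j)\<in>diagonal n (i + Suc m0). entry_val p i j a') =
              (\<Sum>(i, j)\<in>diagonal n (i + Suc m0). entry_val p i j b)"
            using diag[of "i + Suc m0"] step m 2 by simp
        next
          show "(i, Suc m0) \<in> diagonal n (i + Suc m0)"
            using step m 2 by (auto simp: diagonal_def)
        next
          fix i' j' assume ij': "(i', j') \<in> diagonal n (i + Suc m0)" "(i', j') \<noteq> (i, Suc m0)"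
          show "entry_val p i' j' a' = entry_val p i' j' b"
          \<comment> \<open>A later row is settled by the induction hypothesis; an earlier row
            forces \<open>j' \<ge> m\<close>, where both traces vanish.\<close>
          proof (cases "i < i'")
            case True
            then show ?thesis
              using ij' IH by (intro entry_val_cong) (auto simp: diagonal_def)
          next
            case False
            then have "1 \<le> i'" "i' < j'" "m \<le> j'" "j' < p"
              using ij' n m 2 step by (auto simp: diagonal_def)
            then show ?thesis
              using char above above' by (simp add: entry_val_eq_0[of p i' j' m])
          qed
        qed
        then have "a' i = b i"
          using char step a'm \<open>a m \<noteq> 0\<close> 2 IH above'
          by (intro entry_val_inj_below_penultimate[of p i m0 a' b]) auto
        then show ?case
          using IH by (metis le_neq_implies_less)
      qed
      from this[of 1] show ?thesis
        unfolding a'_def by (intro exI[of _ l]) auto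
    qed
  qed
qed

section \<open>Evaluation and group action on polynomials\<close>

text \<open>Evaluation at a point and the action of a group element are both such maps, so they pass
  through norms, traces and diagonal sums.\<close>

locale comm_ring_hom =
  fixes h :: "'a::comm_ring_1 \<Rightarrow> 'b::comm_ring_1"
  assumes add: "h (x + y) = h x + h y"
    and mult: "h (x * y) = h x * h y"
    and one: "h 1 = 1"
begin

lemma zero: "h 0 = 0"
  using add[of 0 0] by simp

lemma sum: "h (sum f A) = (\<Sum>a\<in>A. h (f a))"
  by (induction A rule: infinite_finite_induct) (auto simp: zero add)

lemma prod: "h (prod f A) = (\<Prod>a\<in>A. h (f a))"
  by (induction A rule: infinite_finite_induct) (auto simp: one mult)

lemma power: "h (x ^ k) = h x ^ k"
  by (induction k) (auto simp: one mult)

end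

definition monomial_val :: "(nat \<Rightarrow> 'r::comm_ring_1) \<Rightarrow> (nat \<Rightarrow>\<^sub>0 nat) \<Rightarrow> 'r" where
  "monomial_val s m = (\<Prod>i\<in>Poly_Mapping.keys m. s i ^ Poly_Mapping.lookup m i)"

lemma monomial_val_superset:
  assumes "finite A" "Poly_Mapping.keys m \<subseteq> A"
  shows "monomial_val s m = (\<Prod>i\<in>A. s i ^ Poly_Mapping.lookup m i)"
  unfolding monomial_val_def using assms
  by (intro prod.mono_neutral_left) (auto simp: in_keys_iff)

lemma monomial_val_add: "monomial_val s (m + m') = monomial_val s m * monomial_val s m'"
proof -
  let ?A = "Poly_Mapping.keys m \<union> Poly_Mapping.keys m'"
  have "monomial_val s (m + m') = (\<Prod>i\<in>?A. s i ^ Poly_Mapping.lookup (m + m') i)"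
    using keys_add[of m m'] by (intro monomial_val_superset) auto
  also have "\<dots> = monomial_val s m * monomial_val s m'"
    by (simp add: monomial_val_superset[of ?A] lookup_add power_add prod.distrib)
  finally show ?thesis .
qed

lemma mpoly_hom_superset:
  assumes "c 0 = 0" "finite A" "Poly_Mapping.keys f \<subseteq> A"
  shows "mpoly_hom c s f = (\<Sum>m\<in>A. c (Poly_Mapping.lookup f m) * monomial_val s m)"
  unfolding mpoly_hom_def monomial_val_def[symmetric] using assms
  by (intro sum.mono_neutral_left) (auto simp: in_keys_iff)

text \<open>Reduces additive statements to single monomials.\<close>

lemma poly_mapping_add_induct [case_names zero single add]:
  fixes f :: "'a \<Rightarrow>\<^sub>0 'b::comm_monoid_add"
  assumes "P 0" "\<And>m c. P (Poly_Mapping.single m c)" "\<And>f g. P f \<Longrightarrow> P g \<Longrightarrow> P (f + g)"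
  shows "P f"
proof (induction f rule: update_induct)
  case const
  then show ?case by (rule assms)
next
  case (update f a b)
  have "Poly_Mapping.update a b f = Poly_Mapping.single a b + f"
    using update(1) by (intro poly_mapping_eqI) (auto simp: lookup_update lookup_add lookup_single when_def in_keys_iff)
  then show ?case
    using assms update by simp
qed

context comm_ring_hom
begin

lemma mpoly_hom_add: "mpoly_hom h s (f + g) = mpoly_hom h s f + mpoly_hom h s g"
proof -
  let ?A = "Poly_Mapping.keys f \<union> Poly_Mapping.keys g"
  have "mpoly_hom h s (f + g) = (\<Sum>m\<in>?A. h (Poly_Mapping.lookup (f + g) m) * monomial_val s m)"
    using keys_add[of f g] by (intro mpoly_hom_superset) (auto simp: zero)
  also have "\<dots> = mpoly_hom h s f + mpoly_hom h s g"
    by (simp add: mpoly_hom_superset[of h ?A] zero lookup_add add distrib_right sum.distrib)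
  finally show ?thesis .
qed

lemma mpoly_hom_single: "mpoly_hom h s (Poly_Mapping.single m a) = h a * monomial_val s m"
  using mpoly_hom_superset[of h "{m}" "Poly_Mapping.single m a" s] by (auto simp: zero)

text \<open>Both sides are additive in \<open>f\<close> and in \<open>g\<close>, which leaves a
  product of two monomials, where exponents add.\<close>

lemma mpoly_hom_mult: "mpoly_hom h s (f * g) = mpoly_hom h s f * mpoly_hom h s g"
proof (induction f rule: poly_mapping_add_induct)
  case (single m a)
  show ?case
  proof (induction g rule: poly_mapping_add_induct)
    case (single m' b)
    then show ?case
      by (simp add: mult_single mpoly_hom_single monomial_val_add mult)
  qed (simp_all add: mpoly_hom_def[of _ _ 0] distrib_left mpoly_hom_add)
qed (simp_all add: mpoly_hom_def[of _ _ 0] distrib_right mpoly_hom_add)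

lemma comm_ring_hom_mpoly_hom: "comm_ring_hom (mpoly_hom h s)"
proof
  show "mpoly_hom h s 1 = 1"
    using mpoly_hom_single[of s 0 1] by (simp add: one monomial_val_def)
qed (rule mpoly_hom_add mpoly_hom_mult)+

lemma mpoly_hom_var: "mpoly_hom h s (var i) = s i"
  by (simp add: var_def mpoly_hom_single one monomial_val_def)

lemma mpoly_hom_const: "mpoly_hom h s (const a) = h a"
  by (simp add: const_def mpoly_hom_single one monomial_val_def)

text \<open>A substitution followed by a homomorphism is a substitution again, so composites of
  evaluation and action can be compared on variables.\<close>

lemma map_mpoly_hom: "h (mpoly_hom c s f) = mpoly_hom (\<lambda>a. h (c a)) (\<lambda>i. h (s i)) f"
  by (simp add: mpoly_hom_def sum mult prod power)

end

text \<open>Coordinates are controlled only for indices in \<open>{1..n}\<close>, hence the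
  restriction to \<open>polys n\<close>.\<close>

lemma mpoly_hom_cong:
  assumes "f \<in> polys n" "\<And>i. i \<in> {1..n} \<Longrightarrow> s i = s' i"
  shows "mpoly_hom c s f = mpoly_hom c s' f"
  unfolding mpoly_hom_def using assms
  by (intro sum.cong prod.cong arg_cong2[where f = "(*)"]) (auto simp: polys_def subset_iff)

lemma comm_ring_hom_const: "comm_ring_hom const"
  by standard (auto simp: const_def single_add mult_single)

section \<open>Polynomials in n variables, their evaluation and the action on them\<close>

lemma polys_0: "0 \<in> polys n" and polys_1: "1 \<in> polys n" and polys_const: "const a \<in> polys n"
  by (auto simp: polys_def const_def)

lemma polys_var: "i \<in> {1..n} \<Longrightarrow> var i \<in> polys n"
  by (auto simp: polys_def var_def)

lemma polys_add: "f \<in> polys n \<Longrightarrow> g \<in> polys n \<Longrightarrow> f + g \<in> polys n"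
  using keys_add[of f g] by (auto simp: polys_def)

lemma polys_mult:
  assumes "f \<in> polys n" "g \<in> polys n"
  shows "f * g \<in> polys n"
  unfolding polys_def
proof (intro CollectI ballI)
  fix m assume "m \<in> Poly_Mapping.keys (f * g)"
  then obtain a b where "m = a + b" "a \<in> Poly_Mapping.keys f" "b \<in> Poly_Mapping.keys g"
    using keys_mult[of f g] by blast
  then show "Poly_Mapping.keys m \<subseteq> {1..n}"
    using assms keys_add[of a b] unfolding polys_def by blast
qed

lemma polys_sum: "(\<And>a. a \<in> A \<Longrightarrow> f a \<in> polys n) \<Longrightarrow> sum f A \<in> polys n"
  by (induction A rule: infinite_finite_induct) (auto intro: polys_0 polys_add)

lemma polys_prod: "(\<And>a. a \<in> A \<Longrightarrow> f a \<in> polys n) \<Longrightarrow> prod f A \<in> polys n"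
  by (induction A rule: infinite_finite_induct) (auto intro: polys_1 polys_mult)

lemma polys_power: "f \<in> polys n \<Longrightarrow> f ^ k \<in> polys n"
  by (induction k) (auto intro: polys_1 polys_mult)

lemma linear_form_in_polys: "linear_form n x l \<in> polys n"
  unfolding linear_form_def by (intro polys_sum polys_mult polys_const polys_var)

lemma poly_action_in_polys: "poly_action G \<rho> n x g f \<in> polys n"
  unfolding poly_action_def mpoly_hom_def
  by (intro polys_sum polys_mult polys_prod polys_power polys_const linear_form_in_polys)

lemma comm_ring_hom_eval_at: "comm_ring_hom (eval_at x v)"
  unfolding eval_at_def by (intro comm_ring_hom.comm_ring_hom_mpoly_hom) (standard; simp)

lemma comm_ring_hom_poly_action: "comm_ring_hom (poly_action G \<rho> n x g)"
  unfolding poly_action_def by (intro comm_ring_hom.comm_ring_hom_mpoly_hom comm_ring_hom_const)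

lemma eval_at_const: "eval_at x v (const a) = a"
  unfolding eval_at_def by (rule comm_ring_hom.mpoly_hom_const) (standard; simp)

lemma eval_at_var: "eval_at x v (var i) = x i v"
  unfolding eval_at_def by (rule comm_ring_hom.mpoly_hom_var) (standard; simp)

lemma poly_action_const: "poly_action G \<rho> n x g (const a) = const a"
  unfolding poly_action_def by (rule comm_ring_hom.mpoly_hom_const[OF comm_ring_hom_const])

lemma poly_action_var: "poly_action G \<rho> n x g (var i) = linear_form n x (\<lambda>v. x i (\<rho> (inv\<^bsub>G\<^esub> g) v))"
  unfolding poly_action_def by (rule comm_ring_hom.mpoly_hom_var[OF comm_ring_hom_const])

section \<open>Representations with chosen coordinates\<close>

locale coordinate_representation =
  fixes G :: "('g, 'z) monoid_scheme"
    and scale :: "'k::field \<Rightarrow> 'v::ab_group_add \<Rightarrow> 'v"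
    and \<rho> :: "'g \<Rightarrow> 'v \<Rightarrow> 'v"
    and n :: nat
    and x :: "nat \<Rightarrow> 'v \<Rightarrow> 'k"
  assumes representation: "linear_representation G scale \<rho>"
    and coordinates: "coordinates scale n x"
begin

sublocale group_action G UNIV \<rho>
  using representation by (simp add: linear_representation_def)

lemma is_group: "group G"
  using group_hom by (simp add: group_hom_def)

lemma linear_rho: "g \<in> carrier G \<Longrightarrow> Vector_Spaces.linear scale scale (\<rho> g)"
  using representation by (simp add: linear_representation_def)

lemma linear_coordinate: "i \<in> {1..n} \<Longrightarrow> Vector_Spaces.linear scale (*) (x i)"
  using coordinates by (simp add: coordinates_def)

lemma linear_coordinate_rho:
  "g \<in> carrier G \<Longrightarrow> i \<in> {1..n} \<Longrightarrow> Vector_Spaces.linear scale (*) (\<lambda>v. x i (\<rho> g v))"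
  using linear_rho[of g] linear_coordinate[of i] by (simp add: Vector_Spaces.linear_iff)

lemma coordinates_inject:
  assumes "\<And>i. i \<in> {1..n} \<Longrightarrow> x i v = x i w"
  shows "v = w"
proof -
  have "(\<lambda>i\<in>{1..n}. x i v) = (\<lambda>i\<in>{1..n}. x i w)"
    using assms by (intro restrict_ext) auto
  then show ?thesis
    using coordinates by (auto simp: coordinates_def bij_betw_def dest: injD)
qed

text \<open>Surjectivity of the coordinate map supplies the vector and injectivity its uniqueness,
  so the \<open>THE\<close> in \<open>dual_basis\<close> is meaningful.\<close>

lemma coordinate_dual_basis:
  assumes "i \<in> {1..n}"
  shows "x i (dual_basis n x j) = (if i = j then 1 else 0)"
proof -
  have "(\<lambda>i\<in>{1..n}. if i = j then 1 else 0) \<in> range (\<lambda>v. \<lambda>i\<in>{1..n}. x i v)"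
    using coordinates by (simp add: coordinates_def bij_betw_def)
  then obtain v where v: "(\<lambda>i\<in>{1..n}. if i = j then 1 else 0) = (\<lambda>i\<in>{1..n}. x i v)"
    by blast
  have "x i v = (if i = j then 1 else 0)" if "i \<in> {1..n}" for i
    using fun_cong[OF v, of i] that by simp
  then have "\<exists>!v. \<forall>i\<in>{1..n}. x i v = (if i = j then 1 else 0)"
    by (intro ex1I[of _ v] coordinates_inject) auto
  then show ?thesis
    using assms unfolding dual_basis_def by (rule theI'[THEN bspec])
qed

lemma linear_eq_sum_dual_basis:
  assumes l: "Vector_Spaces.linear scale (*) l"
  shows "l v = (\<Sum>j = 1..n. l (dual_basis n x j) * x j v)"
proof -
  have "v = (\<Sum>j = 1..n. scale (x j v) (dual_basis n x j))"
  proof (rule coordinates_inject)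
    fix i assume i: "i \<in> {1..n}"
    interpret xi: Vector_Spaces.linear scale "(*)" "x i"
      using i by (rule linear_coordinate)
    show "x i v = x i (\<Sum>j = 1..n. scale (x j v) (dual_basis n x j))"
      using i by (simp add: xi.sum xi.scale coordinate_dual_basis if_distrib cong: if_cong)
  qed
  interpret l: Vector_Spaces.linear scale "(*)" l by (rule l)
  have "l v = l (\<Sum>j = 1..n. scale (x j v) (dual_basis n x j))"
    by (rule arg_cong) fact
  then show ?thesis
    by (simp add: l.sum l.scale mult.commute)
qed

lemma eval_at_linear_form:
  assumes "Vector_Spaces.linear scale (*) l"
  shows "eval_at x v (linear_form n x l) = l v"
proof -
  interpret comm_ring_hom "eval_at x v" by (rule comm_ring_hom_eval_at)
  show ?thesis
    unfolding linear_eq_sum_dual_basis[OF assms, of v]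
    by (simp add: linear_form_def sum mult eval_at_const eval_at_var)
qed

text \<open>Links formal substitution to points: both sides are substitutions that agree on the
  variables.\<close>

lemma eval_at_poly_action:
  assumes "g \<in> carrier G" "f \<in> polys n"
  shows "eval_at x v (poly_action G \<rho> n x g f) = eval_at x (\<rho> (inv\<^bsub>G\<^esub> g) v) f"
proof -
  interpret comm_ring_hom "eval_at x v" by (rule comm_ring_hom_eval_at)
  have "inv\<^bsub>G\<^esub> g \<in> carrier G"
    using is_group assms(1) by (rule group.inv_closed)
  then have "eval_at x v (linear_form n x (\<lambda>v. x i (\<rho> (inv\<^bsub>G\<^esub> g) v))) = x i (\<rho> (inv\<^bsub>G\<^esub> g) v)"
    if "i \<in> {1..n}" for i
    using that by (intro eval_at_linear_form linear_coordinate_rho)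
  then have "mpoly_hom (\<lambda>a. a) (\<lambda>i. eval_at x v (linear_form n x (\<lambda>v. x i (\<rho> (inv\<^bsub>G\<^esub> g) v)))) f =
      mpoly_hom (\<lambda>a. a) (\<lambda>i. x i (\<rho> (inv\<^bsub>G\<^esub> g) v)) f"
    using assms(2) by (intro mpoly_hom_cong)
  then show ?thesis
    by (simp add: poly_action_def map_mpoly_hom eval_at_const) (simp add: eval_at_def)
qed

text \<open>The two expansions in the dual basis multiply like matrices.\<close>

lemma poly_action_linear_form:
  assumes "g \<in> carrier G" "Vector_Spaces.linear scale (*) l"
  shows "poly_action G \<rho> n x g (linear_form n x l) = linear_form n x (\<lambda>v. l (\<rho> (inv\<^bsub>G\<^esub> g) v))"
proof -
  interpret comm_ring_hom "poly_action G \<rho> n x g" by (rule comm_ring_hom_poly_action)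
  interpret c: comm_ring_hom "const :: 'k \<Rightarrow> _" by (rule comm_ring_hom_const)
  let ?e = "dual_basis n x"
  have "poly_action G \<rho> n x g (linear_form n x l) =
      (\<Sum>j = 1..n. \<Sum>i = 1..n. const (l (?e j) * x j (\<rho> (inv\<^bsub>G\<^esub> g) (?e i))) * var i)"
    by (simp add: linear_form_def[of n x l] sum mult poly_action_const poly_action_var)
      (simp add: linear_form_def sum_distrib_left c.mult mult.assoc)
  also have "\<dots> = (\<Sum>i = 1..n. const (\<Sum>j = 1..n. l (?e j) * x j (\<rho> (inv\<^bsub>G\<^esub> g) (?e i))) * var i)"
    by (subst sum.swap) (simp add: c.sum sum_distrib_right)
  \<comment> \<open>The inner sum is the expansion of \<open>l\<close> at the moved basis
    vector.\<close>
  also have "\<dots> = linear_form n x (\<lambda>v. l (\<rho> (inv\<^bsub>G\<^esub> g) v))"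
    by (simp only: linear_form_def linear_eq_sum_dual_basis[OF assms(2), symmetric])
  finally show ?thesis .
qed

text \<open>Checked on variables; inverses reverse products, which makes this a left action. It is
  an identity of polynomials, as \<open>invariants\<close> requires.\<close>

lemma poly_action_mult:
  assumes "g \<in> carrier G" "h \<in> carrier G" "f \<in> polys n"
  shows "poly_action G \<rho> n x g (poly_action G \<rho> n x h f) = poly_action G \<rho> n x (g \<otimes>\<^bsub>G\<^esub> h) f"
proof -
  interpret comm_ring_hom "poly_action G \<rho> n x g" by (rule comm_ring_hom_poly_action)
  interpret group G by (rule is_group)
  have "poly_action G \<rho> n x g (linear_form n x (\<lambda>v. x i (\<rho> (inv\<^bsub>G\<^esub> h) v))) =
      linear_form n x (\<lambda>v. x i (\<rho> (inv\<^bsub>G\<^esub> (g \<otimes>\<^bsub>G\<^esub> h)) v))" if "i \<in> {1..n}" for i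
    using assms that
    by (simp add: poly_action_linear_form linear_coordinate_rho inv_mult_group composition_rule)
  then have "mpoly_hom const (\<lambda>i. poly_action G \<rho> n x g (linear_form n x (\<lambda>v. x i (\<rho> (inv\<^bsub>G\<^esub> h) v)))) f =
      mpoly_hom const (\<lambda>i. linear_form n x (\<lambda>v. x i (\<rho> (inv\<^bsub>G\<^esub> (g \<otimes>\<^bsub>G\<^esub> h)) v))) f"
    using assms(3) by (intro mpoly_hom_cong)
  then show ?thesis
    unfolding poly_action_def[of G \<rho> n x h] map_mpoly_hom poly_action_const
    by (simp add: poly_action_def)
qed

end

section \<open>The diagonal sums as separating invariants\<close>

text \<open>The powers below the order exhaust the group, and equal cardinalities give injectivity.
  Norm and trace thereby become a product and a sum over the whole group.\<close>

lemma (in group) bij_betw_generator_powers: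
  assumes "\<sigma> \<in> carrier G" "generate G {\<sigma>} = carrier G" "card (carrier G) = p" "p > 0"
  shows "bij_betw (\<lambda>l::nat. \<sigma> [^] l) {0..<p} (carrier G)"
proof -
  have fin: "finite (carrier G)"
    using assms(3,4) by (intro card_ge_0_finite) simp
  have "ord \<sigma> = p"
    using generate_pow_card[OF assms(1)] assms(2,3) by simp
  have "carrier G = {\<sigma> [^] l | l. l \<in> {0..ord \<sigma> - 1}}"
    using generate_pow_on_finite_carrier[OF fin assms(1)] ord_elems[OF fin assms(1)] assms(2) by simp
  also have "\<dots> = (\<lambda>l. \<sigma> [^] l) ` {0..<p}"
    using assms(4) \<open>ord \<sigma> = p\<close> by auto
  finally show ?thesis
    using assms(3) by (intro bij_betw_imageI eq_card_imp_inj_on) auto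
qed

lemma (in group) bij_betw_translation:
  assumes "g \<in> carrier G"
  shows "bij_betw (\<lambda>h. g \<otimes> h) (carrier G) (carrier G)"
  using assms inj_on_cmult surj_const_mult by (simp add: bij_betw_def)

locale modular_jordan_block = coordinate_representation G scale \<rho> n x
  for G :: "('g, 'z) monoid_scheme"
    and scale :: "'k::field \<Rightarrow> 'v::ab_group_add \<Rightarrow> 'v"
    and \<rho> n x +
  fixes p :: nat and \<sigma> :: 'g
  assumes char: "CHAR('k) = p" and p_pos: "p > 0"
    and n_pos: "1 \<le> n" and n_le_p: "n \<le> p"
    and generator: "\<sigma> \<in> carrier G" "generate G {\<sigma>} = carrier G" "card (carrier G) = p"
    and jordan: "\<And>i. 1 \<le> i \<Longrightarrow> i \<le> n - 1 \<Longrightarrow> poly_action G \<rho> n x \<sigma> (var i) = var i + var (i + 1)"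
    and jordan_last: "poly_action G \<rho> n x \<sigma> (var n) = var n"
begin

sublocale group G
  by (rule is_group)

lemma prime_p: "prime p"
  using prime_CHAR_semidom[where ?'a = 'k] char p_pos by simp

lemma bij_betw_powers: "bij_betw (\<lambda>l. \<sigma> [^]\<^bsub>G\<^esub> (l::nat)) {0..<p} (carrier G)"
  using generator p_pos by (intro bij_betw_generator_powers)

text \<open>Written over the whole group, the product is merely reindexed by left
  translation.\<close>

lemma poly_norm_in_invariants:
  assumes "f \<in> polys n"
  shows "poly_norm G \<rho> n x p \<sigma> f \<in> invariants G \<rho> n x"
proof -
  have eq: "poly_norm G \<rho> n x p \<sigma> f = (\<Prod>h\<in>carrier G. poly_action G \<rho> n x h f)"
    unfolding poly_norm_def by (rule prod.reindex_bij_betw[OF bij_betw_powers])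
  have "poly_action G \<rho> n x g (poly_norm G \<rho> n x p \<sigma> f) = poly_norm G \<rho> n x p \<sigma> f"
    if "g \<in> carrier G" for g
  proof -
    interpret comm_ring_hom "poly_action G \<rho> n x g" by (rule comm_ring_hom_poly_action)
    show ?thesis
      using that assms prod.reindex_bij_betw[OF bij_betw_translation[OF that], of "\<lambda>h. poly_action G \<rho> n x h f"]
      by (simp add: eq prod poly_action_mult)
  qed
  then show ?thesis
    unfolding invariants_def by (auto simp: poly_norm_def intro: polys_prod poly_action_in_polys)
qed

lemma poly_trace_in_invariants:
  assumes "f \<in> polys n"
  shows "poly_trace G \<rho> n x p \<sigma> f \<in> invariants G \<rho> n x"
proof -
  have eq: "poly_trace G \<rho> n x p \<sigma> f = (\<Sum>h\<in>carrier G. poly_action G \<rho> n x h f)"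
    unfolding poly_trace_def by (rule sum.reindex_bij_betw[OF bij_betw_powers])
  have "poly_action G \<rho> n x g (poly_trace G \<rho> n x p \<sigma> f) = poly_trace G \<rho> n x p \<sigma> f"
    if "g \<in> carrier G" for g
  proof -
    interpret comm_ring_hom "poly_action G \<rho> n x g" by (rule comm_ring_hom_poly_action)
    show ?thesis
      using that assms sum.reindex_bij_betw[OF bij_betw_translation[OF that], of "\<lambda>h. poly_action G \<rho> n x h f"]
      by (simp add: eq sum poly_action_mult)
  qed
  then show ?thesis
    unfolding invariants_def by (auto simp: poly_trace_def intro: polys_sum poly_action_in_polys)
qed

lemma last_var_power_in_invariants: "var n ^ k \<in> invariants G \<rho> n x"
proof -
  have n: "n \<in> {1..n}" using n_pos by simp
  have fixed: "poly_action G \<rho> n x (\<sigma> [^]\<^bsub>G\<^esub> l) (var n) = var n" for l :: nat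
  proof (induction l)
    case 0
    \<comment> \<open>The identity substitutes the linear form of \<open>x n\<close>, whose only
      nonzero coefficient belongs to \<open>var n\<close>.\<close>
    have "linear_form n x (x n) = (\<Sum>j = 1..n. if j = n then var j else 0)"
      unfolding linear_form_def
      by (intro sum.cong) (use n in \<open>auto simp: coordinate_dual_basis const_def simp flip: single_one\<close>)
    also have "\<dots> = var n"
      using n_pos by simp
    finally show ?case
      using id_eq_one by (simp add: poly_action_var flip: id_eq_one)
  next
    case (Suc l)
    have "poly_action G \<rho> n x (\<sigma> [^]\<^bsub>G\<^esub> Suc l) (var n) =
        poly_action G \<rho> n x (\<sigma> [^]\<^bsub>G\<^esub> l) (poly_action G \<rho> n x \<sigma> (var n))"
      using generator n by (simp add: poly_action_mult polys_var)
    then show ?case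
      by (simp add: jordan_last Suc)
  qed
  have "poly_action G \<rho> n x g (var n ^ k) = var n ^ k" if g: "g \<in> carrier G" for g
  proof -
    interpret comm_ring_hom "poly_action G \<rho> n x g" by (rule comm_ring_hom_poly_action)
    obtain l :: nat where "g = \<sigma> [^]\<^bsub>G\<^esub> l"
      using bij_betw_powers g by (auto simp: bij_betw_def)
    then show ?thesis
      using fixed[of l] unfolding power by simp
  qed
  then show ?thesis
    unfolding invariants_def using polys_power[OF polys_var[OF n]] by auto
qed

lemma invariants_sum:
  assumes "\<And>a. a \<in> A \<Longrightarrow> f a \<in> invariants G \<rho> n x"
  shows "sum f A \<in> invariants G \<rho> n x"
proof -
  have "poly_action G \<rho> n x g (sum f A) = sum f A" if "g \<in> carrier G" for g
  proof -
    interpret comm_ring_hom "poly_action G \<rho> n x g" by (rule comm_ring_hom_poly_action)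
    show ?thesis
      unfolding sum using assms that by (intro sum.cong) (auto simp: invariants_def)
  qed
  then show ?thesis
    using assms unfolding invariants_def by (auto intro: polys_sum)
qed

lemma diagonal_sums_subset_invariants: "diagonal_sums G \<rho> n x p \<sigma> \<subseteq> invariants G \<rho> n x"
proof -
  have "array_entry G \<rho> n x p \<sigma> i j \<in> invariants G \<rho> n x" if "(i, j) \<in> array_positions n" for i j
  proof -
    have "i \<in> {1..n}" "j \<in> {1..n}"
      using that n_pos by (auto simp: array_positions_def)
    then show ?thesis
      unfolding array_entry_def
      by (auto intro!: last_var_power_in_invariants poly_norm_in_invariants poly_trace_in_invariants
          polys_mult polys_power polys_var)
  qed
  then show ?thesis
    unfolding diagonal_sums_def diagonal_sum_def
    by (auto intro!: invariants_sum last_var_power_in_invariants)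
qed

text \<open>Padding by zero turns \<open>\<sigma> x_n = x_n\<close> into an instance of the rule for
  \<open>x_i\<close>, and discards the arbitrary values of \<open>x\<close> at other
  indices.\<close>

definition coord_seq :: "'v \<Rightarrow> nat \<Rightarrow> 'k" where
  "coord_seq v i = (if i \<in> {1..n} then x i v else 0)"

text \<open>The Jordan relation for \<open>\<sigma>\<close> on functions, read at \<open>v\<close>,
  describes its inverse on points.\<close>

lemma coord_seq_rho_inv_generator:
  assumes "1 \<le> i"
  shows "coord_seq (\<rho> (inv\<^bsub>G\<^esub> \<sigma>) v) i = shift_add (coord_seq v) i"
proof -
  interpret comm_ring_hom "eval_at x v" by (rule comm_ring_hom_eval_at)
  have eval: "x i (\<rho> (inv\<^bsub>G\<^esub> \<sigma>) v) = eval_at x v (poly_action G \<rho> n x \<sigma> (var i))" if "i \<le> n"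
    using that assms generator(1) by (simp add: eval_at_poly_action polys_var eval_at_var)
  consider "i \<le> n - 1" "i < n" | "i = n" | "n < i"
    by linarith
  then show ?thesis
  proof cases
    case 1
    then show ?thesis
      using assms eval jordan[of i] by (simp add: coord_seq_def shift_add_def add eval_at_var)
  next
    case 2
    then show ?thesis
      using n_pos eval jordan_last by (simp add: coord_seq_def shift_add_def eval_at_var)
  qed (simp add: coord_seq_def shift_add_def)
qed

lemma coord_seq_rho_inv_power:
  "1 \<le> i \<Longrightarrow> coord_seq (\<rho> (inv\<^bsub>G\<^esub> (\<sigma> [^]\<^bsub>G\<^esub> (l::nat))) v) i = (shift_add ^^ l) (coord_seq v) i"
proof (induction l arbitrary: i)
  case 0
  then show ?case by (simp flip: id_eq_one)
next
  case (Suc l)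
  have "\<rho> (inv\<^bsub>G\<^esub> (\<sigma> [^]\<^bsub>G\<^esub> Suc l)) v = \<rho> (inv\<^bsub>G\<^esub> \<sigma>) (\<rho> (inv\<^bsub>G\<^esub> (\<sigma> [^]\<^bsub>G\<^esub> l)) v)"
    using generator(1) by (simp add: inv_mult_group composition_rule)
  then show ?case
    using Suc by (simp add: coord_seq_rho_inv_generator funpow_Suc_shift_add shift_add_def[of "coord_seq _"]
        del: funpow.simps)
qed

lemma eval_at_array_entry:
  assumes "1 \<le> i" "i \<le> j" "j \<le> n - 1"
  shows "eval_at x v (array_entry G \<rho> n x p \<sigma> i j) = entry_val p i j (coord_seq v)"
proof -
  interpret comm_ring_hom "eval_at x v" by (rule comm_ring_hom_eval_at)
  have ij: "i \<in> {1..n}" "j \<in> {1..n}" "j \<noteq> n"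
    using assms n_pos by auto
  have eval: "eval_at x v (poly_action G \<rho> n x (\<sigma> [^]\<^bsub>G\<^esub> l) (var k)) = (shift_add ^^ l) (coord_seq v) k"
    if "k \<in> {1..n}" for k and l :: nat
    using that generator(1) coord_seq_rho_inv_power[of k l v]
    by (simp add: eval_at_poly_action polys_var eval_at_var coord_seq_def)
  have act: "poly_action G \<rho> n x g (var i * var j ^ q) =
      poly_action G \<rho> n x g (var i) * poly_action G \<rho> n x g (var j) ^ q" for g q
  proof -
    interpret comm_ring_hom "poly_action G \<rho> n x g" by (rule comm_ring_hom_poly_action)
    show ?thesis by (simp add: mult power)
  qed
  show ?thesis
    using ij by (simp add: array_entry_def entry_val_def norm_val_def trace_val_def poly_norm_def poly_trace_def
        prod sum mult power eval act atLeast0LessThan)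
qed

lemma eval_at_diagonal_sum:
  assumes "k \<in> {2..2 * n - 2}"
  shows "eval_at x v (diagonal_sum G \<rho> n x p \<sigma> k) = (\<Sum>(i, j)\<in>diagonal n k. entry_val p i j (coord_seq v))"
proof -
  interpret comm_ring_hom "eval_at x v" by (rule comm_ring_hom_eval_at)
  \<comment> \<open>The bound on \<open>k\<close> excludes \<open>(n, n)\<close>, whose index sum is
    \<open>2 * n\<close>.\<close>
  have "{(i, j) \<in> array_positions n. i + j = k} = diagonal n k"
    using assms n_pos by (auto simp: array_positions_def diagonal_def)
  then have "eval_at x v (diagonal_sum G \<rho> n x p \<sigma> k) =
      (\<Sum>(i, j)\<in>diagonal n k. eval_at x v (array_entry G \<rho> n x p \<sigma> i j))"
    by (simp add: diagonal_sum_def sum case_prod_beta)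
  also have "\<dots> = (\<Sum>(i, j)\<in>diagonal n k. entry_val p i j (coord_seq v))"
    by (intro sum.cong) (auto simp: diagonal_def eval_at_array_entry)
  finally show ?thesis .
qed

lemma orbit_eq_if_diagonal_sums_eq:
  assumes "\<And>h. h \<in> diagonal_sums G \<rho> n x p \<sigma> \<Longrightarrow> eval_at x v h = eval_at x w h"
  shows "orbit G \<rho> v = orbit G \<rho> w"
proof -
  have "\<exists>l. \<forall>i\<ge>1. coord_seq w i = (shift_add ^^ l) (coord_seq v) i"
  proof (rule diagonal_coincidence_imp_same_orbit[OF char prime_p n_le_p])
    fix k assume k: "k \<in> {2..2 * n - 2}"
    then have "eval_at x v (diagonal_sum G \<rho> n x p \<sigma> k) = eval_at x w (diagonal_sum G \<rho> n x p \<sigma> k)"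
      by (intro assms) (simp add: diagonal_sums_def)
    then show "(\<Sum>(i, j)\<in>diagonal n k. entry_val p i j (coord_seq v)) =
        (\<Sum>(i, j)\<in>diagonal n k. entry_val p i j (coord_seq w))"
      using k by (simp add: eval_at_diagonal_sum)
  next
    have "eval_at x v (var n ^ p) = eval_at x w (var n ^ p)"
      by (intro assms) (simp add: diagonal_sums_def)
    then show "coord_seq v n ^ p = coord_seq w n ^ p"
      using n_pos by (simp add: coord_seq_def comm_ring_hom.power[OF comm_ring_hom_eval_at] eval_at_var)
  qed (simp_all add: coord_seq_def)
  then obtain l where l: "\<forall>i\<ge>1. coord_seq w i = (shift_add ^^ l) (coord_seq v) i"
    by blast
  \<comment> \<open>The coordinates determine the vector, so equality of sequences lifts to the
    representation.\<close>
  have "w = \<rho> (inv\<^bsub>G\<^esub> (\<sigma> [^]\<^bsub>G\<^esub> l)) v"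
  proof (rule coordinates_inject)
    fix i assume i: "i \<in> {1..n}"
    then have "coord_seq w i = coord_seq (\<rho> (inv\<^bsub>G\<^esub> (\<sigma> [^]\<^bsub>G\<^esub> l)) v) i"
      using l by (simp add: coord_seq_rho_inv_power)
    then show "x i w = x i (\<rho> (inv\<^bsub>G\<^esub> (\<sigma> [^]\<^bsub>G\<^esub> l)) v)"
      using i by (simp add: coord_seq_def)
  qed
  then have "w \<in> orbit G \<rho> v"
    using generator(1) by (auto simp: orbit_def)
  then show ?thesis
    using orbit_sym orbit_trans by blast
qed

end

theorem proposition5p2:
  fixes p n :: nat
    and G :: "('g, 'z) monoid_scheme"
    and \<sigma> :: 'g
    and scale :: "'k::alg_closed_field \<Rightarrow> 'v::ab_group_add \<Rightarrow> 'v"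
    and \<rho> :: "'g \<Rightarrow> 'v \<Rightarrow> 'v"
    and x :: "nat \<Rightarrow> 'v \<Rightarrow> 'k"
  assumes "CHAR('k) = p" and "p > 0"
    and "1 \<le> n" and "n \<le> p"
    and "group G" and "\<sigma> \<in> carrier G"
    and "generate G {\<sigma>} = carrier G" and "card (carrier G) = p"
    and "vector_space scale"
    and "linear_representation G scale \<rho>"
    and "indecomposable G scale \<rho>"
    and "coordinates scale n x"
    and "\<And>i. 1 \<le> i \<Longrightarrow> i \<le> n - 1 \<Longrightarrow> poly_action G \<rho> n x \<sigma> (var i) = var i + var (i + 1)"
    and "poly_action G \<rho> n x \<sigma> (var n) = var n"
  shows "separating_set G \<rho> n x (diagonal_sums G \<rho> n x p \<sigma>)"
proof -
  interpret modular_jordan_block G scale \<rho> n x p \<sigma>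
    using assms by unfold_locales auto
  show ?thesis
    unfolding separating_set_def
    using diagonal_sums_subset_invariants orbit_eq_if_diagonal_sums_eq by blast
qed

end
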